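(* The change of basis $\frac{x}{(1-x)^{k+1}}\mapsto x(1-x)^{k-1}$ ($k\ge 1$), extended linearly, is an operadic isomorphism of algebras over the operad $\mathcal{FP}$ of finite posets from the algebra of weak order series $\{\mathfrak{Z}^+(P)\}$ to the algebra of weak surjective order series $\{\mathfrak{Z}^{s}(P)\}$, where $P$ ranges over finite posets.
   Context: Posets are finite and nonempty. For a poset $P$ on points $x_1,\dots,x_k$ and posets $Q_1,\dots,Q_k$, the lexicographic sum $\widetilde{P}(Q_1,\dots,Q_k)$ is the poset on $\bigsqcup_i Q_i$ with $a\le b$ iff either $a,b\in Q_i$ for some $i$ and $a\le_{Q_i}b$, or $a\in Q_i$, $b\in Q_j$ with $x_i<_P x_j$. The operad $\mathcal{FP}$ has as $k$-ary operations the posets with $k$ points, with lexicographic sum as operadic composition. $\Omega^\circ(P,n)$ is the number of strict order-preserving maps $P\to\langle n\rangle=\{1<\cdots<n\}$, and the integers $d_{P,i}$ are defined by $\Omega^\circ(P,x)=\sum_{i=1}^{|P|}d_{P,i}\binom{x}{i}$. Define $$\mathfrak{Z}^+(P)=\sum_{n\ge 1}\Omega(P,n)x^n=\sum_{i=1}^{|P|}(-1)^{|P|-i}d_{P,i}\frac{x}{(1-x)^{i+1}},\qquad \mathfrak{Z}^{s}(P)=\sum_{i=1}^{|P|}(-1)^{|P|-i}d_{P,i}\,x(1-x)^{i-1},$$ where $\Omega(P,n)$ is the number of weakly order-preserving maps $P\to\langle n\rangle$. Elements of both algebras are series together with the poset that produced them, and the action of $\mathcal{FP}$ is $$\widetilde{P}(\mathfrak{Z}^{\bullet}(P_1),\dots,\mathfrak{Z}^{\bullet}(P_k))=\mathfrak{Z}^{\bullet}(\widetilde{P}(P_1,\dots,P_k)),\qquad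 k=|P|,\ \bullet\in\{+,s\}.$$ An operadic isomorphism is a bijection commuting with all these actions. *)

theory Defs
  imports "HOL-Computational_Algebra.Formal_Power_Series" "HOL-Library.FuncSet"
begin

section \<open>The operad of finite posets\<close>

text \<open>
  A poset is given by its (reflexive) order relation \<open>P\<close>; its underlying set is \<open>Field P\<close>.
  The \<open>k\<close>-ary operations are the nonempty posets on the points \<open>x\<^sub>1, \<dots>, x\<^sub>k\<close>, where
  the point \<open>x\<^sub>i\<close> is encoded as the number \<open>i - 1\<close>, so that it indexes lists of arguments.
\<close>

definition FP :: "nat \<Rightarrow> nat rel set" where
  "FP k = {P. k \<ge> 1 \<and> partial_order_on {..<k} P}"

definition finite_posets :: "nat rel set" where
  "finite_posets = (\<Union>k. FP k)"

definition lex_sum :: "'i rel \<Rightarrow> ('i \<Rightarrow> 'a rel) \<Rightarrow> ('i \<times> 'a) rel" where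
  "lex_sum P Q =
     {((i, a), (j, b)) | i j a b. i \<in> Field P \<and> i = j \<and> (a, b) \<in> Q i} \<union>
     {((i, a), (j, b)) | i j a b. (i, j) \<in> P \<and> i \<noteq> j \<and> a \<in> Field (Q i) \<and> b \<in> Field (Q j)}"

text \<open>
  The underlying set of \<open>lex_sum P (\<lambda>i. Qs ! i)\<close> is the disjoint union of the underlying sets of
  the \<open>Qs ! i\<close>. It is identified with an initial segment of the natural numbers by placing these
  sets one after the other.
\<close>

definition block_label :: "nat rel list \<Rightarrow> nat \<times> nat \<Rightarrow> nat" where
  "block_label Qs = (\<lambda>(i, a). (\<Sum>j<i. card (Field (Qs ! j))) + a)"

definition lex_comp :: "nat rel \<Rightarrow> nat rel list \<Rightarrow> nat rel" where
  "lex_comp P Qs =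
     map_prod (block_label Qs) (block_label Qs) ` lex_sum P (\<lambda>i. Qs ! i)"

text \<open>
  Algebras over the operad, with carrier \<open>A\<close> and with \<open>act P [a\<^sub>1, \<dots>, a\<^sub>k]\<close> the action of the
  \<open>k\<close>-ary operation \<open>P\<close>: the action is closed, unital, and compatible with operadic composition.
\<close>

definition FP_algebra :: "'b set \<Rightarrow> (nat rel \<Rightarrow> 'b list \<Rightarrow> 'b) \<Rightarrow> bool" where
  "FP_algebra A act \<longleftrightarrow>
     (\<forall>k. \<forall>P\<in>FP k. \<forall>xs. length xs = k \<and> set xs \<subseteq> A \<longrightarrow> act P xs \<in> A) \<and>
     (\<forall>a\<in>A. act {(0, 0)} [a] = a) \<and>
     (\<forall>k. \<forall>P\<in>FP k. \<forall>Qs xss.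
        length Qs = k \<and> length xss = k \<and>
        (\<forall>i<k. Qs ! i \<in> FP (length (xss ! i)) \<and> set (xss ! i) \<subseteq> A) \<longrightarrow>
        act (lex_comp P Qs) (concat xss) = act P (map2 act Qs xss))"

definition operadic_isomorphism ::
    "'b set \<Rightarrow> (nat rel \<Rightarrow> 'b list \<Rightarrow> 'b) \<Rightarrow> 'c set \<Rightarrow> (nat rel \<Rightarrow> 'c list \<Rightarrow> 'c) \<Rightarrow> ('b \<Rightarrow> 'c) \<Rightarrow> bool"
  where
  "operadic_isomorphism A actA B actB F \<longleftrightarrow>
     bij_betw F A B \<and>
     (\<forall>k. \<forall>P\<in>FP k. \<forall>xs. length xs = k \<and> set xs \<subseteq> A \<longrightarrow>
        F (actA P xs) = actB P (map F xs))"

section \<open>Order polynomials and order series\<close>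

definition weak_count :: "'p rel \<Rightarrow> nat \<Rightarrow> nat" where
  "weak_count P n = card {f \<in> Field P \<rightarrow>\<^sub>E {1..n}. \<forall>(a, b)\<in>P. f a \<le> f b}"

definition strict_count :: "'p rel \<Rightarrow> nat \<Rightarrow> nat" where
  "strict_count P n = card {f \<in> Field P \<rightarrow>\<^sub>E {1..n}. \<forall>(a, b)\<in>P. a \<noteq> b \<longrightarrow> f a < f b}"

definition d_coeff :: "'p rel \<Rightarrow> nat \<Rightarrow> int" where
  "d_coeff P = (THE d.
     (\<forall>i. i \<notin> {1..card (Field P)} \<longrightarrow> d i = 0) \<and>
     (\<forall>n. int (strict_count P n) = (\<Sum>i = 1..card (Field P). d i * int (n choose i))))"

definition weak_order_series :: "'p rel \<Rightarrow> 'a::field_char_0 fps" where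
  "weak_order_series P = Abs_fps (\<lambda>n. if n \<ge> 1 then of_nat (weak_count P n) else 0)"

definition weak_surj_series :: "'p rel \<Rightarrow> 'a::field_char_0 fps" where
  "weak_surj_series P =
     (\<Sum>i = 1..card (Field P).
        (-1) ^ (card (Field P) - i) * of_int (d_coeff P i) * (fps_X * (1 - fps_X) ^ (i - 1)))"

text \<open>
  The algebra attached to a family \<open>Z\<close> of series indexed by posets; its elements are the series
  together with the poset that produced them.
\<close>

definition series_algebra :: "(nat rel \<Rightarrow> 's) \<Rightarrow> (nat rel \<times> 's) set" where
  "series_algebra Z = {(P, Z P) | P. P \<in> finite_posets}"

definition series_action :: "(nat rel \<Rightarrow> 's) \<Rightarrow> nat rel \<Rightarrow> (nat rel \<times> 's) list \<Rightarrow> nat rel \<times> 's" where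
  "series_action Z P xs = (let R = lex_comp P (map fst xs) in (R, Z R))"

section \<open>The change of basis\<close>

definition fps_scale :: "'a::field_char_0 \<Rightarrow> 'a fps \<Rightarrow> 'a fps" where
  "fps_scale c f = fps_const c * f"

definition weak_basis :: "'a::field_char_0 fps set" where
  "weak_basis = {fps_X / (1 - fps_X) ^ (k + 1) | k. k \<ge> 1}"

text \<open>
  \<open>\<phi>\<close> is the linear extension of the change of basis to the linear span of \<open>weak_basis\<close>; its
  values outside this span are irrelevant.
\<close>

definition is_change_of_basis :: "('a::field_char_0 fps \<Rightarrow> 'a fps) \<Rightarrow> bool" where
  "is_change_of_basis \<phi> \<longleftrightarrow>
     (\<forall>f\<in>module.span fps_scale weak_basis. \<forall>g\<in>module.span fps_scale weak_basis.
        \<phi> (f + g) = \<phi> f + \<phi> g) \<and>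
     (\<forall>c. \<forall>f\<in>module.span fps_scale weak_basis. \<phi> (fps_scale c f) = fps_scale c (\<phi> f)) \<and>
     (\<forall>k\<ge>1. \<phi> (fps_X / (1 - fps_X) ^ (k + 1)) = fps_X * (1 - fps_X) ^ (k - 1))"

end

(*
  The elements of both algebras remember their posets, so the operadic content is that lexicographic
  sum is an operad composition and that the change of basis maps the weak order series of P to its
  weak surjective order series.  The latter amounts to the expansion of the weak order series in the
  basis x / (1 - x)^(i + 1), which is Stanley's reciprocity for order polynomials.  For an
  incomparable pair a, b, the strict maps of P split into those of P with a < b added, P with b < a
  added, and the quotient identifying a and b; the weak maps satisfy the same relation with the sign
  of the quotient reversed.  Since the quotient has one point less, this reduces reciprocity to
  chains, where both counts are binomial coefficients.
*)
theory Submission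
  imports Defs
begin

section \<open>Lexicographic composition\<close>

lemma Field_eq_of_partial_order_on:
  assumes "partial_order_on V P"
  shows "Field P = V"
  using partial_order_onD[OF assms] by (auto simp: Field_def refl_on_def)

lemma partial_order_onI_pointwise:
  assumes "P \<subseteq> V \<times> V" "\<And>x. x \<in> V \<Longrightarrow> (x, x) \<in> P"
    and "\<And>x y. (x, y) \<in> P \<Longrightarrow> (y, x) \<in> P \<Longrightarrow> x = y"
    and "\<And>x y z. (x, y) \<in> P \<Longrightarrow> (y, z) \<in> P \<Longrightarrow> (x, z) \<in> P"
  shows "partial_order_on V P"
  using assms unfolding partial_order_on_def preorder_on_def refl_on_def antisym_def trans_def
  by blast

lemma FP_D:
  assumes "P \<in> FP k"
  shows "k \<ge> 1" "partial_order_on {..<k} P" "Field P = {..<k}" "P \<subseteq> {..<k} \<times> {..<k}"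
  using assms Field_eq_of_partial_order_on[of "{..<k}" P] partial_order_onD[of "{..<k}" P]
  by (auto simp: FP_def)

lemma FP_refl: "P \<in> FP k \<Longrightarrow> i < k \<Longrightarrow> (i, i) \<in> P"
  using partial_order_onD(1)[OF FP_D(2)] by (auto simp: refl_on_def)

lemma FP_antisym: "P \<in> FP k \<Longrightarrow> (i, j) \<in> P \<Longrightarrow> (j, i) \<in> P \<Longrightarrow> i = j"
  using partial_order_onD(3)[OF FP_D(2)] by (auto simp: antisym_def)

lemma FP_trans: "P \<in> FP k \<Longrightarrow> (i, j) \<in> P \<Longrightarrow> (j, l) \<in> P \<Longrightarrow> (i, l) \<in> P"
  using partial_order_onD(2)[OF FP_D(2)] by (auto simp: trans_def)

lemma finite_posets_FP:
  assumes "P \<in> finite_posets"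
  shows "P \<in> FP (card (Field P))"
  using assms FP_D(3) by (force simp: finite_posets_def)

section \<open>Block coordinates on an initial segment of the natural numbers\<close>

text \<open>Existence of block coordinates: consecutive blocks of lengths \<open>n 0\<close>,
  \<open>n 1\<close>, ... cover the initial segment, so \<open>x\<close> has a block
  \<open>i\<close> and a position \<open>a\<close> in it. Uniqueness is
  \<open>block_eq_iff\<close>.\<close>

lemma block_decomposition:
  fixes n :: "nat \<Rightarrow> nat"
  assumes "x < (\<Sum>j<k. n j)"
  obtains i a where "i < k" "a < n i" "x = (\<Sum>j<i. n j) + a"
  using assms
proof (induction k arbitrary: thesis)
  case (Suc k)
  show ?case
  proof (cases "x < (\<Sum>j<k. n j)")
    case True
    then show ?thesis using Suc.IH Suc.prems(1) less_Suc_eq by metis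
  next
    case False
    then show ?thesis
      using Suc.prems(1)[of k "x - (\<Sum>j<k. n j)"] Suc.prems(2) by auto
  qed
qed simp

lemma block_less:
  fixes n :: "nat \<Rightarrow> nat"
  assumes "i < j" "a < n i"
  shows "(\<Sum>l<i. n l) + a < (\<Sum>l<j. n l)"
proof -
  have "(\<Sum>l<i. n l) + a < (\<Sum>l<Suc i. n l)"
    using assms by simp
  also have "\<dots> \<le> (\<Sum>l<j. n l)"
    using assms by (intro sum_mono2) auto
  finally show ?thesis .
qed

lemma block_eq_iff:
  fixes n :: "nat \<Rightarrow> nat"
  assumes "a < n i" "b < n j"
  shows "(\<Sum>l<i. n l) + a = (\<Sum>l<j. n l) + b \<longleftrightarrow> i = j \<and> a = b"
  using block_less[of i j a n] block_less[of j i b n] assms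
  by (cases i j rule: linorder_cases) auto

text \<open>The additional \<open>m\<close> terms after the full blocks allow sums that stop in the
  middle of a block, as the offsets in the associativity proof do. They also drive the induction,
  where the last full block is taken as the value of \<open>m\<close>.\<close>

lemma sum_blocks:
  fixes n :: "nat \<Rightarrow> nat" and f :: "nat \<Rightarrow> 'a::comm_monoid_add"
  shows "(\<Sum>x<(\<Sum>j<k. n j) + m. f x) =
    (\<Sum>i<k. \<Sum>a<n i. f ((\<Sum>j<i. n j) + a)) + (\<Sum>a<m. f ((\<Sum>j<k. n j) + a))"
proof (induction k arbitrary: m)
  case (Suc k)
  have split: "(\<Sum>x<u + v. f x) = (\<Sum>x<u. f x) + (\<Sum>a<v. f (u + a))" for u v
    by (induction v) (auto simp: add.assoc)
  have "(\<Sum>x<(\<Sum>j<Suc k. n j) + m. f x) =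
      (\<Sum>x<(\<Sum>j<k. n j) + n k. f x) + (\<Sum>a<m. f ((\<Sum>j<Suc k. n j) + a))"
    unfolding split[of "\<Sum>j<Suc k. n j"] by simp
  then show ?case
    by (simp add: Suc.IH)
qed simp

lemma length_concat_blocks: "length (concat xss) = (\<Sum>j<length xss. length (xss ! j))"
  by (induction xss) (simp_all add: sum.lessThan_Suc_shift del: sum.lessThan_Suc)

lemma nth_concat_blocks:
  assumes "i < length xss" "a < length (xss ! i)"
  shows "concat xss ! ((\<Sum>j<i. length (xss ! j)) + a) = xss ! i ! a"
  using assms
proof (induction xss arbitrary: i)
  case (Cons xs xss)
  then show ?case
    by (cases i) (simp_all add: nth_append sum.lessThan_Suc_shift del: sum.lessThan_Suc)
qed simp

section \<open>Lexicographic composition: closure, unit and associativity\<close>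

text \<open>The block sizes are a parameter \<open>n\<close> rather than cardinalities of fields,
  since associativity instantiates them by lengths of lists and by sums of smaller block
  sizes.\<close>

locale lex_composition =
  fixes P :: "nat rel" and Qs :: "nat rel list" and n :: "nat \<Rightarrow> nat"
  assumes P: "P \<in> FP (length Qs)"
    and Qs: "\<And>i. i < length Qs \<Longrightarrow> Qs ! i \<in> FP (n i)"
begin

abbreviation offset :: "nat \<Rightarrow> nat" where
  "offset i \<equiv> \<Sum>j<i. n j"

lemma block_label_eq: "i < length Qs \<Longrightarrow> block_label Qs (i, a) = offset i + a"
  using FP_D(3)[OF Qs] by (simp add: block_label_def)

lemma mem_lex_comp:
  "(x, y) \<in> lex_comp P Qs \<longleftrightarrow>
    (\<exists>i j a b. x = offset i + a \<and> y = offset j + b \<and> i < length Qs \<and> j < length Qs \<and>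
      a < n i \<and> b < n j \<and> (i = j \<and> (a, b) \<in> Qs ! i \<or> i \<noteq> j \<and> (i, j) \<in> P))"
  (is "?L \<longleftrightarrow> ?R")
proof
  assume ?L
  then obtain i j a b where x: "x = block_label Qs (i, a)" and y: "y = block_label Qs (j, b)"
    and ij: "i \<in> Field P \<and> i = j \<and> (a, b) \<in> Qs ! i \<or>
      (i, j) \<in> P \<and> i \<noteq> j \<and> a \<in> Field (Qs ! i) \<and> b \<in> Field (Qs ! j)"
    unfolding lex_comp_def lex_sum_def by auto
  have "i < length Qs" "j < length Qs"
    using ij FP_D(3,4)[OF P] by auto
  moreover from this have "a < n i" "b < n j"
    using ij FP_D(3,4)[OF Qs, of i] FP_D(3)[OF Qs, of j] by auto
  ultimately show ?R
    using ij x y block_label_eq by metis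
next
  assume ?R
  then obtain i j a b where *: "x = offset i + a" "y = offset j + b"
      "i < length Qs" "j < length Qs" "a < n i" "b < n j"
      "i = j \<and> (a, b) \<in> Qs ! i \<or> i \<noteq> j \<and> (i, j) \<in> P" by blast
  have "((i, a), (j, b)) \<in> lex_sum P (\<lambda>i. Qs ! i)"
    using * FP_D(3)[OF P] FP_D(3)[OF Qs] by (auto simp: lex_sum_def)
  moreover have "(x, y) = map_prod (block_label Qs) (block_label Qs) ((i, a), (j, b))"
    using * block_label_eq by simp
  ultimately show ?L
    unfolding lex_comp_def by blast
qed

text \<open>Block coordinates are unique, so the quantifiers of \<open>mem_lex_comp\<close>
  disappear once the coordinates of both points are given. This is the working form of the
  order.\<close>

lemma lex_comp_iff:
  assumes "i < length Qs" "j < length Qs" "a < n i" "b < n j"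
  shows "(offset i + a, offset j + b) \<in> lex_comp P Qs \<longleftrightarrow>
    i = j \<and> (a, b) \<in> Qs ! i \<or> i \<noteq> j \<and> (i, j) \<in> P"
proof
  assume "(offset i + a, offset j + b) \<in> lex_comp P Qs"
  then obtain i' j' a' b' where *: "offset i + a = offset i' + a'" "offset j + b = offset j' + b'"
      "a' < n i'" "b' < n j'" "i' = j' \<and> (a', b') \<in> Qs ! i' \<or> i' \<noteq> j' \<and> (i', j') \<in> P"
    unfolding mem_lex_comp by blast
  then show "i = j \<and> (a, b) \<in> Qs ! i \<or> i \<noteq> j \<and> (i, j) \<in> P"
    using block_eq_iff[of a n i a' i'] block_eq_iff[of b n j b' j'] assms by auto
qed (use assms in \<open>unfold mem_lex_comp, blast\<close>)

lemma lex_comp_subset: "lex_comp P Qs \<subseteq> {..<offset (length Qs)} \<times> {..<offset (length Qs)}"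
  using block_less by (auto simp: mem_lex_comp)

lemma lex_comp_FP: "lex_comp P Qs \<in> FP (offset (length Qs))"
proof -
  have len: "0 < length Qs"
    using FP_D(1)[OF P] by linarith
  have "1 \<le> n 0"
    using FP_D(1)[OF Qs[OF len]] .
  then have "1 \<le> offset (length Qs)"
    using block_less[of 0 "length Qs" 0 n] len by simp
  moreover have "partial_order_on {..<offset (length Qs)} (lex_comp P Qs)"
  proof (rule partial_order_onI_pointwise[OF lex_comp_subset])
    fix x assume "x \<in> {..<offset (length Qs)}"
    then obtain i a where "i < length Qs" "a < n i" "x = offset i + a"
      using block_decomposition by (metis lessThan_iff)
    then show "(x, x) \<in> lex_comp P Qs"
      using FP_refl[OF Qs] by (simp add: lex_comp_iff)
  next
    fix x y assume xy: "(x, y) \<in> lex_comp P Qs" and yx: "(y, x) \<in> lex_comp P Qs"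
    obtain i j a b where *: "x = offset i + a" "y = offset j + b"
      "i < length Qs" "j < length Qs" "a < n i" "b < n j"
      using xy unfolding mem_lex_comp by blast
    show "x = y"
      using xy yx * lex_comp_iff[of i j a b] lex_comp_iff[of j i b a]
        FP_antisym[OF P] FP_antisym[OF Qs] by auto
  next
    fix x y z assume xy: "(x, y) \<in> lex_comp P Qs" and yz: "(y, z) \<in> lex_comp P Qs"
    obtain i j a b where 1: "x = offset i + a" "y = offset j + b"
      "i < length Qs" "j < length Qs" "a < n i" "b < n j"
      using xy unfolding mem_lex_comp by blast
    obtain l c where 2: "z = offset l + c" "l < length Qs" "c < n l"
      using yz unfolding mem_lex_comp by blast
    have ij: "i = j \<and> (a, b) \<in> Qs ! i \<or> i \<noteq> j \<and> (i, j) \<in> P"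
      using xy 1 lex_comp_iff[of i j a b] by simp
    have jl: "j = l \<and> (b, c) \<in> Qs ! j \<or> j \<noteq> l \<and> (j, l) \<in> P"
      using yz 1 2 lex_comp_iff[of j l b c] by simp
    \<comment> \<open>If both steps change the block, then \<open>i \<noteq> l\<close>: otherwise
      antisymmetry of \<open>P\<close> would give \<open>i = j\<close>.\<close>
    have "i = l \<and> (a, c) \<in> Qs ! i \<or> i \<noteq> l \<and> (i, l) \<in> P"
      using ij jl FP_trans[OF P] FP_trans[OF Qs] FP_antisym[OF P] 1 by metis
    then show "(x, z) \<in> lex_comp P Qs"
      using 1 2 lex_comp_iff[of i l a c] by simp
  qed
  ultimately show ?thesis
    by (simp add: FP_def)
qed

end

text \<open>With a single block the offset is an empty sum, so relabelling just forgets the index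
  0.\<close>

lemma lex_comp_unit:
  assumes "Q \<in> FP k"
  shows "lex_comp {(0, 0)} [Q] = Q"
proof -
  have "Field {(0::nat, 0::nat)} = {0}"
    by (auto simp: Field_def)
  then show ?thesis
    by (force simp: lex_comp_def lex_sum_def block_label_def)
qed

text \<open>Every point has coordinates \<open>(i, a, c)\<close>: outer block, inner block,
  position. Both sides give it the same number, and both compare two points in \<open>P\<close> if
  the outer blocks differ, in \<open>Qs ! i\<close> if only the inner blocks differ, and in
  \<open>Rss ! i ! a\<close> otherwise.\<close>

lemma lex_comp_assoc:
  assumes P: "P \<in> FP (length Qs)" and len: "length Rss = length Qs"
    and Qs: "\<And>i. i < length Qs \<Longrightarrow> Qs ! i \<in> FP (length (Rss ! i))"
    and Rss: "\<And>i a. i < length Qs \<Longrightarrow> a < length (Rss ! i) \<Longrightarrow> Rss ! i ! a \<in> finite_posets"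
  shows "lex_comp (lex_comp P Qs) (concat Rss) = lex_comp P (map2 lex_comp Qs Rss)"
proof -
  define k where "k = length Qs"
  define n where "n i = length (Rss ! i)" for i
  define r where "r i a = card (Field (Rss ! i ! a))" for i a
  define N where "N i = (\<Sum>a<n i. r i a)" for i
  define m where "m x = card (Field (concat Rss ! x))" for x
  define s where "s i = (\<Sum>j<i. n j)" for i
  have nth: "concat Rss ! (s i + a) = Rss ! i ! a" if "i < k" "a < n i" for i a
    using that nth_concat_blocks[of i Rss a] len by (simp add: k_def n_def s_def)
  have length_concat: "length (concat Rss) = s k"
    by (simp add: length_concat_blocks k_def n_def s_def len)
  have m: "m (s i + a) = r i a" if "i < k" "a < n i" for i a
    using nth[OF that] by (simp add: m_def r_def)
  \<comment> \<open>The offset of the flattened block \<open>s i + a\<close> is the outer offset of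
    block \<open>i\<close> plus the offset of \<open>a\<close> inside it. Hence the two nestings
    number the points alike.\<close>
  have sum_m: "(\<Sum>x<s i + a. m x) = (\<Sum>j<i. N j) + (\<Sum>b<a. r i b)" if "i < k" "a \<le> n i" for i a
  proof -
    have "(\<Sum>x<s i + a. m x) = (\<Sum>j<i. \<Sum>b<n j. m (s j + b)) + (\<Sum>b<a. m (s i + b))"
      unfolding s_def by (rule sum_blocks)
    also have "\<dots> = (\<Sum>j<i. N j) + (\<Sum>b<a. r i b)"
      unfolding N_def using that by (intro arg_cong2[of _ _ _ _ "(+)"] sum.cong refl m) auto
    finally show ?thesis .
  qed
  interpret PQ: lex_composition P Qs n
    by unfold_locales (use P Qs n_def in auto)
  have R: "Rss ! i ! a \<in> FP (r i a)" if "i < k" "a < n i" for i a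
    using Rss[of i a] that finite_posets_FP unfolding k_def n_def r_def by blast
  have QR: "lex_composition (Qs ! i) (Rss ! i) (r i)" if "i < k" for i
    by unfold_locales (use that Qs R k_def n_def in auto)
  interpret L: lex_composition "lex_comp P Qs" "concat Rss" m
  proof
    show "lex_comp P Qs \<in> FP (length (concat Rss))"
      using PQ.lex_comp_FP by (simp add: length_concat s_def k_def)
    fix x assume "x < length (concat Rss)"
    then obtain i a where "i < k" "a < n i" "x = s i + a"
      unfolding length_concat s_def by (rule block_decomposition)
    then show "concat Rss ! x \<in> FP (m x)"
      using R m nth by simp
  qed
  interpret R: lex_composition P "map2 lex_comp Qs Rss" N
  proof
    show "P \<in> FP (length (map2 lex_comp Qs Rss))"
      using P len by simp
    fix i assume "i < length (map2 lex_comp Qs Rss)"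
    then show "map2 lex_comp Qs Rss ! i \<in> FP (N i)"
      using lex_composition.lex_comp_FP[OF QR, of i] len by (simp add: N_def k_def n_def)
  qed
  have len_map: "length (map2 lex_comp Qs Rss) = k"
    using len by (simp add: k_def)
  have s_less: "s i + a < s k" if "i < k" "a < n i" for i a
    using block_less[of i k a n] that by (simp add: s_def)
  have total: "(\<Sum>x<s k. m x) = (\<Sum>j<k. N j)"
    using sum_blocks[where f = m and k = k and n = n and m = 0] m by (simp add: s_def N_def)
  have agree: "(x, y) \<in> lex_comp (lex_comp P Qs) (concat Rss) \<longleftrightarrow>
      (x, y) \<in> lex_comp P (map2 lex_comp Qs Rss)"
    if x: "x < (\<Sum>j<k. N j)" and y: "y < (\<Sum>j<k. N j)" for x y
  proof -
    obtain i u where i: "i < k" "u < N i" "x = (\<Sum>l<i. N l) + u"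
      using x by (rule block_decomposition)
    obtain a c where a: "a < n i" "c < r i a" "u = (\<Sum>l<a. r i l) + c"
      using i(2) unfolding N_def by (rule block_decomposition)
    obtain j v where j: "j < k" "v < N j" "y = (\<Sum>l<j. N l) + v"
      using y by (rule block_decomposition)
    obtain b e where b: "b < n j" "e < r j b" "v = (\<Sum>l<b. r j l) + e"
      using j(2) unfolding N_def by (rule block_decomposition)
    have x_eq: "x = (\<Sum>l<s i + a. m l) + c" and y_eq: "y = (\<Sum>l<s j + b. m l) + e"
      using sum_m[of i a] sum_m[of j b] i j a b by auto
    have PQ: "(s i + a, s j + b) \<in> lex_comp P Qs \<longleftrightarrow>
        i = j \<and> (a, b) \<in> Qs ! i \<or> i \<noteq> j \<and> (i, j) \<in> P"
      using PQ.lex_comp_iff[of i j a b] i j a b by (simp add: k_def s_def)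
    have eq: "s i + a = s j + b \<longleftrightarrow> i = j \<and> a = b"
      using block_eq_iff[of a n i b j] a b by (simp add: s_def)
    have "(x, y) \<in> lex_comp (lex_comp P Qs) (concat Rss) \<longleftrightarrow>
        (i = j \<and> a = b) \<and> (c, e) \<in> Rss ! i ! a \<or>
        \<not> (i = j \<and> a = b) \<and> (i = j \<and> (a, b) \<in> Qs ! i \<or> i \<noteq> j \<and> (i, j) \<in> P)"
      unfolding x_eq y_eq
      using L.lex_comp_iff[of "s i + a" "s j + b" c e] i j a b s_less m nth
      by (simp add: length_concat PQ eq)
    moreover have "(u, v) \<in> lex_comp (Qs ! i) (Rss ! i) \<longleftrightarrow>
        a = b \<and> (c, e) \<in> Rss ! i ! a \<or> a \<noteq> b \<and> (a, b) \<in> Qs ! i" if "i = j"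
      using lex_composition.lex_comp_iff[OF QR[OF i(1)], of a b c e] a b that by (simp add: n_def)
    moreover have "(x, y) \<in> lex_comp P (map2 lex_comp Qs Rss) \<longleftrightarrow>
        i = j \<and> (u, v) \<in> lex_comp (Qs ! i) (Rss ! i) \<or> i \<noteq> j \<and> (i, j) \<in> P"
      using R.lex_comp_iff[of i j u v] i j len by (simp add: k_def)
    ultimately show ?thesis
      by blast
  qed
  show ?thesis
    \<comment> \<open>By \<open>total\<close> both relations live on the same initial segment, where
      they agree.\<close>
    using L.lex_comp_subset R.lex_comp_subset agree
    unfolding length_concat len_map total by auto
qed

section \<open>Reciprocity for order polynomials\<close>

definition strict_maps :: "'p rel \<Rightarrow> nat \<Rightarrow> ('p \<Rightarrow> nat) set" where
  "strict_maps P n = {f \<in> Field P \<rightarrow>\<^sub>E {1..n}. \<forall>(a, b)\<in>P. a \<noteq> b \<longrightarrow> f a < f b}"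

definition weak_maps :: "'p rel \<Rightarrow> nat \<Rightarrow> ('p \<Rightarrow> nat) set" where
  "weak_maps P n = {f \<in> Field P \<rightarrow>\<^sub>E {1..n}. \<forall>(a, b)\<in>P. f a \<le> f b}"

lemma strict_count_eq_card: "strict_count P n = card (strict_maps P n)"
  by (simp add: strict_count_def strict_maps_def)

lemma weak_count_eq_card: "weak_count P n = card (weak_maps P n)"
  by (simp add: weak_count_def weak_maps_def)

lemma strict_maps_iff:
  assumes "Field P = V"
  shows "f \<in> strict_maps P n \<longleftrightarrow> (\<forall>x\<in>V. 1 \<le> f x \<and> f x \<le> n) \<and> f \<in> extensional V \<and>
    (\<forall>x y. (x, y) \<in> P \<longrightarrow> x \<noteq> y \<longrightarrow> f x < f y)"
  unfolding strict_maps_def assms PiE_def Pi_def by auto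

lemma weak_maps_iff:
  assumes "Field P = V"
  shows "f \<in> weak_maps P n \<longleftrightarrow> (\<forall>x\<in>V. 1 \<le> f x \<and> f x \<le> n) \<and> f \<in> extensional V \<and>
    (\<forall>x y. (x, y) \<in> P \<longrightarrow> f x \<le> f y)"
  unfolding weak_maps_def assms PiE_def Pi_def by auto

lemma finite_strict_maps: "finite (Field P) \<Longrightarrow> finite (strict_maps P n)"
  by (rule finite_subset[of _ "Field P \<rightarrow>\<^sub>E {1..n}"])
    (auto simp: strict_maps_def intro: finite_PiE)

lemma finite_weak_maps: "finite (Field P) \<Longrightarrow> finite (weak_maps P n)"
  by (rule finite_subset[of _ "Field P \<rightarrow>\<^sub>E {1..n}"])
    (auto simp: weak_maps_def intro: finite_PiE)

text \<open>Restriction away from \<open>t\<close> is a bijection, as \<open>h\<close> recovers the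
  value at \<open>t\<close> from the others. It serves for deleting the top of a chain
  (\<open>h\<close> constant) and for merging \<open>b\<close> into \<open>a\<close>
  (\<open>h g = g a\<close>).\<close>

lemma card_eq_of_determined_value:
  assumes S: "S \<subseteq> extensional V" and T: "T \<subseteq> extensional (V - {t})" and "t \<in> V"
    and restr: "\<And>f. f \<in> S \<Longrightarrow> restrict f (V - {t}) \<in> T \<and> f t = h (restrict f (V - {t}))"
    and upd: "\<And>g. g \<in> T \<Longrightarrow> g(t := h g) \<in> S"
  shows "card S = card T"
proof (rule bij_betw_same_card)
  have "restrict (g(t := h g)) (V - {t}) = g" if "g \<in> T" for g
    using T that by (auto simp: extensional_def restrict_def fun_eq_iff)
  moreover have "(restrict f (V - {t}))(t := h (restrict f (V - {t}))) = f" if "f \<in> S" for f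
    using S that restr[OF that] by (auto simp: extensional_def restrict_def fun_eq_iff)
  ultimately show "bij_betw (\<lambda>f. restrict f (V - {t})) S T"
    using restr upd by (intro bij_betw_byWitness[where f' = "\<lambda>g. g(t := h g)"]) auto
qed

section \<open>Order polynomials of chains\<close>

lemma linear_order_has_greatest:
  assumes "linear_order_on V P" "finite V" "V \<noteq> {}"
  obtains t where "t \<in> V" "\<And>x. x \<in> V \<Longrightarrow> (x, t) \<in> P"
proof -
  \<comment> \<open>Stated for all nonempty subsets of \<open>V\<close>, so that points can be added
    one at a time while \<open>P\<close> stays fixed.\<close>
  have "\<exists>t\<in>S. \<forall>x\<in>S. (x, t) \<in> P" if "finite S" "S \<noteq> {}" "S \<subseteq> V" for S
    using that
  proof (induction S rule: finite_ne_induct)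
    case (singleton x)
    then show ?case
      using assms(1) by (auto simp: order_on_defs refl_on_def)
  next
    case (insert y S)
    then obtain t where t: "t \<in> S" "\<forall>x\<in>S. (x, t) \<in> P" by blast
    have y: "y \<in> V" "t \<in> V" "y \<noteq> t" "(y, y) \<in> P"
      using insert t assms(1) by (auto simp: order_on_defs refl_on_def)
    then consider "(t, y) \<in> P" | "(y, t) \<in> P"
      using assms(1) by (auto simp: linear_order_on_def total_on_def)
    then show ?case
    proof cases
      case 1
      have "trans P"
        using assms(1) by (simp add: order_on_defs)
      then have "(x, y) \<in> P" if "x \<in> S" for x
        using transD[of P x t y] t(2) 1 that by blast
      then show ?thesis using y by blast
    qed (use t in blast)
  qed
  from this[OF assms(2,3) order_refl] show ?thesis
    using that by blast
qed

text \<open>Split the maps by whether the greatest point \<open>t\<close> takes the value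
  \<open>Suc n\<close>. If not, all values are at most \<open>n\<close>, because \<open>t\<close>
  has the largest one. If so, delete \<open>t\<close>: the other values are at most \<open>n\<close>
  in the strict case but may still be \<open>Suc n\<close> in the weak case, which explains the
  different last arguments.\<close>

lemma maps_linear_order_Suc:
  assumes lin: "linear_order_on V P" and fin: "finite V"
    and t: "t \<in> V" "\<And>x. x \<in> V \<Longrightarrow> (x, t) \<in> P"
  defines "P' \<equiv> P \<inter> (V - {t}) \<times> (V - {t})"
  shows "linear_order_on (V - {t}) P'"
    and "strict_count P (Suc n) = strict_count P n + strict_count P' n"
    and "weak_count P (Suc n) = weak_count P n + weak_count P' (Suc n)"
proof -
  have part: "partial_order_on V P"
    using lin by (simp add: linear_order_on_def)
  show lin': "linear_order_on (V - {t}) P'"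
    using lin unfolding P'_def order_on_defs refl_on_def antisym_def trans_def total_on_def by blast
  have F: "Field P = V"
    using part by (rule Field_eq_of_partial_order_on)
  have F': "Field P' = V - {t}"
    using lin' by (intro Field_eq_of_partial_order_on) (simp add: linear_order_on_def)
  have tx: "(t, x) \<in> P \<Longrightarrow> x = t" and sub: "(x, y) \<in> P \<Longrightarrow> x \<in> V \<and> y \<in> V" for x y
    using t(2) partial_order_onD[OF part] by (auto simp: antisym_def)
  note strict_iff = strict_maps_iff[OF F] and strict_iff' = strict_maps_iff[OF F']
    and weak_iff = weak_maps_iff[OF F] and weak_iff' = weak_maps_iff[OF F']
  have strict_t: "f x < f t" if "f \<in> strict_maps P m" "x \<in> V" "x \<noteq> t" for f x m
    using that t(2)[of x] unfolding strict_iff by blast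
  have weak_t: "f x \<le> f t" if "f \<in> weak_maps P m" "x \<in> V" for f x m
    using that t(2)[of x] unfolding weak_iff by blast
  have "card {f \<in> strict_maps P (Suc n). f t = Suc n} = card (strict_maps P' n)"
  proof (rule card_eq_of_determined_value[where V = V and t = t and h = "\<lambda>_. Suc n"])
    fix f assume f: "f \<in> {f \<in> strict_maps P (Suc n). f t = Suc n}"
    then have f': "f \<in> strict_maps P (Suc n)" by simp
    have "f x \<le> n" if "x \<in> V - {t}" for x
      using strict_t[OF f', of x] that f by simp
    moreover have "restrict f (V - {t}) x < restrict f (V - {t}) y"
      if "(x, y) \<in> P'" "x \<noteq> y" for x y
      using that f' unfolding strict_iff P'_def by simp
    ultimately show "restrict f (V - {t}) \<in> strict_maps P' n \<and> f t = Suc n"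
      using f unfolding strict_iff' by (simp add: strict_iff)
  next
    fix g assume g: "g \<in> strict_maps P' n"
    have "(g(t := Suc n)) x < (g(t := Suc n)) y" if "(x, y) \<in> P" "x \<noteq> y" for x y
    proof (cases "y = t")
      case True
      then have "x \<in> V - {t}" using that sub by blast
      then have "g x \<le> n" using g unfolding strict_iff' by blast
      then show ?thesis using True that by simp
    next
      case False
      then have "x \<noteq> t" "(x, y) \<in> P'" using that tx sub unfolding P'_def by blast+
      then show ?thesis using g False that unfolding strict_iff' by simp
    qed
    then show "g(t := Suc n) \<in> {f \<in> strict_maps P (Suc n). f t = Suc n}"
      using g t(1) unfolding strict_iff' by (auto simp: strict_iff extensional_def le_SucI)
  qed (use t(1) in \<open>auto simp: strict_iff strict_iff'\<close>)
  moreover have "strict_maps P (Suc n) = strict_maps P n \<union> {f \<in> strict_maps P (Suc n). f t = Suc n}"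
  proof (intro equalityI subsetI)
    fix f assume f: "f \<in> strict_maps P (Suc n)"
    have "f x \<le> n" if "x \<in> V" "f t \<noteq> Suc n" for x
    proof -
      have "f t \<le> n" using f t(1) that(2) unfolding strict_iff by (metis le_Suc_eq)
      moreover have "f x \<le> f t" using strict_t[OF f, of x] that(1) by (cases "x = t") auto
      ultimately show ?thesis by simp
    qed
    then show "f \<in> strict_maps P n \<union> {f \<in> strict_maps P (Suc n). f t = Suc n}"
      using f by (auto simp: strict_iff)
  qed (auto simp: strict_iff)
  moreover have "strict_maps P n \<inter> {f \<in> strict_maps P (Suc n). f t = Suc n} = {}"
    using t(1) by (force simp: strict_iff)
  ultimately show "strict_count P (Suc n) = strict_count P n + strict_count P' n"
    using finite_strict_maps[of P n] finite_strict_maps[of P "Suc n"] fin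
      card_Un_disjoint[of "strict_maps P n" "{f \<in> strict_maps P (Suc n). f t = Suc n}"]
    by (simp add: F strict_count_eq_card)
  have "card {f \<in> weak_maps P (Suc n). f t = Suc n} = card (weak_maps P' (Suc n))"
  proof (rule card_eq_of_determined_value[where V = V and t = t and h = "\<lambda>_. Suc n"])
    fix f assume f: "f \<in> {f \<in> weak_maps P (Suc n). f t = Suc n}"
    then have "restrict f (V - {t}) x \<le> restrict f (V - {t}) y" if "(x, y) \<in> P'" for x y
      using that unfolding P'_def by (simp add: weak_iff)
    then show "restrict f (V - {t}) \<in> weak_maps P' (Suc n) \<and> f t = Suc n"
      using f unfolding weak_iff' by (simp add: weak_iff)
  next
    fix g assume g: "g \<in> weak_maps P' (Suc n)"
    have "(g(t := Suc n)) x \<le> (g(t := Suc n)) y" if "(x, y) \<in> P" for x y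
    proof (cases "y = t")
      case True
      then have "x = t \<or> g x \<le> Suc n" using g that sub unfolding weak_iff' by blast
      then show ?thesis using True by auto
    next
      case False
      then have "x \<noteq> t" "(x, y) \<in> P'" using that tx sub unfolding P'_def by blast+
      then show ?thesis using g False unfolding weak_iff' by simp
    qed
    then show "g(t := Suc n) \<in> {f \<in> weak_maps P (Suc n). f t = Suc n}"
      using g t(1) unfolding weak_iff' by (auto simp: weak_iff extensional_def)
  qed (use t(1) in \<open>auto simp: weak_iff weak_iff'\<close>)
  moreover have "weak_maps P (Suc n) = weak_maps P n \<union> {f \<in> weak_maps P (Suc n). f t = Suc n}"
  proof (intro equalityI subsetI)
    fix f assume f: "f \<in> weak_maps P (Suc n)"
    have "f x \<le> n" if "x \<in> V" "f t \<noteq> Suc n" for x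
    proof -
      have "f t \<le> n" using f t(1) that(2) unfolding weak_iff by (metis le_Suc_eq)
      then show ?thesis using weak_t[OF f that(1)] by simp
    qed
    then show "f \<in> weak_maps P n \<union> {f \<in> weak_maps P (Suc n). f t = Suc n}"
      using f by (auto simp: weak_iff)
  qed (auto simp: weak_iff)
  moreover have "weak_maps P n \<inter> {f \<in> weak_maps P (Suc n). f t = Suc n} = {}"
    using t(1) by (force simp: weak_iff)
  ultimately show "weak_count P (Suc n) = weak_count P n + weak_count P' (Suc n)"
    using finite_weak_maps[of P n] finite_weak_maps[of P "Suc n"] fin
      card_Un_disjoint[of "weak_maps P n" "{f \<in> weak_maps P (Suc n). f t = Suc n}"]
    by (simp add: F weak_count_eq_card)
qed

text \<open>Induction on the size of the chain and, inside it, on \<open>n\<close>: the two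
  recurrences for removing the greatest point are instances of Pascal's rule.\<close>

lemma counts_linear_order:
  assumes "finite V" "linear_order_on V P"
  shows "strict_count P n = n choose card V"
    and "weak_count P n = (n + card V - 1) choose card V"
proof -
  have "strict_count P n = n choose card V \<and> weak_count P n = (n + card V - 1) choose card V"
    using assms
  proof (induction "card V" arbitrary: V P n)
    case 0
    then have "P = {}" "V = {}"
      by (auto simp: order_on_defs)
    then show ?case
      by (simp add: strict_count_def weak_count_def)
  next
    case (Suc k)
    then obtain t where t: "t \<in> V" "\<And>x. x \<in> V \<Longrightarrow> (x, t) \<in> P"
      by (metis card.empty linear_order_has_greatest nat.distinct(1))
    note step = maps_linear_order_Suc[OF Suc.prems(2,1) t]
    have k: "card (V - {t}) = k"
      using Suc t(1) by simp
    define P' where "P' = P \<inter> (V - {t}) \<times> (V - {t})"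
    have IH: "strict_count P' m = m choose k \<and> weak_count P' m = (m + k - 1) choose k" for m
      using Suc.hyps(1)[of "V - {t}" P' m] step(1) k Suc.prems(1) by (simp add: P'_def)
    have F: "Field P = V"
      using Suc.prems(2) by (intro Field_eq_of_partial_order_on) (simp add: linear_order_on_def)
    show ?case
    proof (induction n)
      case 0
      \<comment> \<open>A nonempty set has no map into the empty set; in both binomials the lower
        index then exceeds the upper one.\<close>
      have "V \<rightarrow>\<^sub>E {1..0::nat} = {}"
        using t(1) by (auto simp: PiE_def Pi_def)
      then show ?case
        using Suc.hyps(2)[symmetric] by (simp add: strict_count_def weak_count_def F)
    next
      case (Suc n)
      then show ?case
        using IH[of n] IH[of "Suc n"] step(2,3)[of n] \<open>Suc k = card V\<close>[symmetric]
        by (simp flip: P'_def)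
    qed
  qed
  then show "strict_count P n = n choose card V" "weak_count P n = (n + card V - 1) choose card V"
    by auto
qed

section \<open>Splitting a poset at an incomparable pair\<close>

text \<open>For a partial order with \<open>a\<close> and \<open>b\<close> among its points, this is
  the transitive closure of \<open>P\<close> with the pair \<open>(a, b)\<close> added: a path
  through the new pair, even repeatedly, starts below \<open>a\<close> and ends above
  \<open>b\<close>.\<close>

definition order_extension :: "'p rel \<Rightarrow> 'p \<Rightarrow> 'p \<Rightarrow> 'p rel" where
  "order_extension P a b = P \<union> {(x, y). (x, a) \<in> P \<and> (b, y) \<in> P}"

text \<open>The quotient of \<open>P\<close> identifying \<open>b\<close> with \<open>a\<close>, carried by the points other than \<open>b\<close>.\<close>

definition order_merge :: "'p rel \<Rightarrow> 'p \<Rightarrow> 'p \<Rightarrow> 'p rel" where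
  "order_merge P a b =
     {(x, y) \<in> order_extension P a b \<union> order_extension P b a. x \<noteq> b \<and> y \<noteq> b}"

locale incomparable_pair =
  fixes V :: "'p set" and P :: "'p rel" and a b :: 'p
  assumes finite: "finite V" and poset: "partial_order_on V P"
    and ab: "a \<in> V" "b \<in> V" "(a, b) \<notin> P" "(b, a) \<notin> P"
begin

lemma swap: "incomparable_pair V P b a"
  by unfold_locales (use finite poset ab in auto)

lemma refl: "x \<in> V \<Longrightarrow> (x, x) \<in> P" and trans: "(x, y) \<in> P \<Longrightarrow> (y, z) \<in> P \<Longrightarrow> (x, z) \<in> P"
  and antisym: "(x, y) \<in> P \<Longrightarrow> (y, x) \<in> P \<Longrightarrow> x = y"
  and subset: "(x, y) \<in> P \<Longrightarrow> x \<in> V \<and> y \<in> V"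
  using partial_order_onD[OF poset] by (auto simp: refl_on_def trans_def antisym_def)

lemma distinct: "a \<noteq> b"
  using ab refl by auto

text \<open>Antisymmetry is the critical property: a cycle through a new pair would yield
  \<open>(b, a) \<in> P\<close>, against incomparability.\<close>

lemma poset_extension: "partial_order_on V (order_extension P a b)"
proof (rule partial_order_onI_pointwise)
  show "order_extension P a b \<subseteq> V \<times> V"
    using subset by (auto simp: order_extension_def)
  show "(x, x) \<in> order_extension P a b" if "x \<in> V" for x
    using refl that by (auto simp: order_extension_def)
  show "x = y" if "(x, y) \<in> order_extension P a b" "(y, x) \<in> order_extension P a b" for x y
    using that antisym trans ab(4) unfolding order_extension_def by blast
  show "(x, z) \<in> order_extension P a b"
    if "(x, y) \<in> order_extension P a b" "(y, z) \<in> order_extension P a b" for x y z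
    using that trans unfolding order_extension_def by blast
qed

lemma poset_merge: "partial_order_on (V - {b}) (order_merge P a b)"
proof (rule partial_order_onI_pointwise)
  show "order_merge P a b \<subseteq> (V - {b}) \<times> (V - {b})"
    using subset by (auto simp: order_merge_def order_extension_def)
  show "(x, x) \<in> order_merge P a b" if "x \<in> V - {b}" for x
    using refl that by (auto simp: order_merge_def order_extension_def)
  show "x = y"
    if xy_mem: "(x, y) \<in> order_merge P a b" and yx_mem: "(y, x) \<in> order_merge P a b" for x y
  proof -
    have xy: "(x, y) \<in> P \<or> (x, a) \<in> P \<and> (b, y) \<in> P \<or> (x, b) \<in> P \<and> (a, y) \<in> P"
      and yx: "(y, x) \<in> P \<or> (y, a) \<in> P \<and> (b, x) \<in> P \<or> (y, b) \<in> P \<and> (a, x) \<in> P"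
      using xy_mem yx_mem by (auto simp: order_merge_def order_extension_def)
    \<comment> \<open>The only cycles that do not make \<open>a\<close> and \<open>b\<close>
      comparable pass through the pair once in each direction. They squeeze \<open>x\<close> or
      \<open>y\<close> between \<open>b\<close> and \<open>b\<close>, and \<open>b\<close> is no
      point of the quotient.\<close>
    have not_both: "\<not> ((u, b) \<in> P \<and> (b, u) \<in> P)" if "u = x \<or> u = y" for u
      using xy_mem antisym[of u b] that by (auto simp: order_merge_def)
    have "(x, y) \<in> P \<and> (y, x) \<in> P"
      using xy yx by (elim disjE conjE) (metis trans ab(3,4) not_both)+
    then show ?thesis
      using antisym by blast
  qed
  show "(x, z) \<in> order_merge P a b"
    if "(x, y) \<in> order_merge P a b" "(y, z) \<in> order_merge P a b" for x y z
  proof -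
    have xy: "(x, y) \<in> P \<or> (x, a) \<in> P \<and> (b, y) \<in> P \<or> (x, b) \<in> P \<and> (a, y) \<in> P"
      and yz: "(y, z) \<in> P \<or> (y, a) \<in> P \<and> (b, z) \<in> P \<or> (y, b) \<in> P \<and> (a, z) \<in> P"
      and "x \<noteq> b" "z \<noteq> b"
      using that by (auto simp: order_merge_def order_extension_def)
    \<comment> \<open>Passing through the pair twice in the same direction would make
      \<open>a\<close> and \<open>b\<close> comparable; in opposite directions it gives
      \<open>(x, z) \<in> P\<close> by way of \<open>a\<close> or of \<open>b\<close>.\<close>
    have "(x, z) \<in> P \<or> (x, a) \<in> P \<and> (b, z) \<in> P \<or> (x, b) \<in> P \<and> (a, z) \<in> P"
      using xy yz by (elim disjE conjE) (metis trans ab(3,4))+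
    then show ?thesis
      using \<open>x \<noteq> b\<close> \<open>z \<noteq> b\<close> by (auto simp: order_merge_def order_extension_def)
  qed
qed

lemma Field_eq:
  "Field P = V" "Field (order_extension P a b) = V" "Field (order_merge P a b) = V - {b}"
  using Field_eq_of_partial_order_on poset poset_extension poset_merge by blast+

lemmas strict_iff = Field_eq[THEN strict_maps_iff]
lemmas weak_iff = Field_eq[THEN weak_maps_iff]

lemma strict_maps_mono: "f \<in> strict_maps P n \<Longrightarrow> (x, y) \<in> P \<Longrightarrow> f x \<le> f y"
  unfolding strict_iff by (cases "x = y") (auto intro: less_imp_le)

lemma order_extension_base: "(a, b) \<in> order_extension P a b"
  using refl ab by (auto simp: order_extension_def)

lemma subset_order_extension: "P \<subseteq> order_extension P a b"
  by (auto simp: order_extension_def)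

text \<open>The pairs added by transitivity impose nothing beyond \<open>f a < f b\<close>, since
  \<open>f x \<le> f a < f b \<le> f y\<close> for them.\<close>

lemma strict_maps_extension:
  "strict_maps (order_extension P a b) n = {f \<in> strict_maps P n. f a < f b}"
proof (intro equalityI subsetI)
  fix f assume f: "f \<in> strict_maps (order_extension P a b) n"
  have lt: "f x < f y" if "(x, y) \<in> order_extension P a b" "x \<noteq> y" for x y
    using f that by (simp add: strict_iff)
  show "f \<in> {f \<in> strict_maps P n. f a < f b}"
    using f lt[OF order_extension_base distinct] lt[OF subsetD[OF subset_order_extension]]
    by (simp add: strict_iff)
next
  fix f assume f: "f \<in> {f \<in> strict_maps P n. f a < f b}"
  have "f x < f y" if "(x, a) \<in> P" "(b, y) \<in> P" for x y
    using f strict_maps_mono[of f n x a] strict_maps_mono[of f n b y] that by simp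
  then have "f x < f y" if "(x, y) \<in> order_extension P a b" "x \<noteq> y" for x y
    using that f by (auto simp: order_extension_def strict_iff)
  then show "f \<in> strict_maps (order_extension P a b) n"
    using f by (simp add: strict_iff)
qed

lemma weak_maps_extension:
  "weak_maps (order_extension P a b) n = {f \<in> weak_maps P n. f a \<le> f b}"
proof (intro equalityI subsetI)
  fix f assume f: "f \<in> weak_maps (order_extension P a b) n"
  have le: "f x \<le> f y" if "(x, y) \<in> order_extension P a b" for x y
    using f that by (simp add: weak_iff)
  show "f \<in> {f \<in> weak_maps P n. f a \<le> f b}"
    using f le[OF order_extension_base] le[OF subsetD[OF subset_order_extension]]
    by (simp add: weak_iff)
next
  fix f assume f: "f \<in> {f \<in> weak_maps P n. f a \<le> f b}"
  then have le: "f x \<le> f y" if "(x, y) \<in> P" for x y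
    using that by (simp add: weak_iff)
  have "f x \<le> f y" if "(x, a) \<in> P" "(b, y) \<in> P" for x y
    using f le[OF that(1)] le[OF that(2)] by simp
  then have "f x \<le> f y" if "(x, y) \<in> order_extension P a b" for x y
    using that le by (auto simp: order_extension_def)
  then show "f \<in> weak_maps (order_extension P a b) n"
    using f by (simp add: weak_iff)
qed

lemma order_merge_cases:
  assumes "(x, y) \<in> order_merge P a b"
  obtains "(x, y) \<in> P" | "(x, a) \<in> P" "(b, y) \<in> P" | "(x, b) \<in> P" "(a, y) \<in> P"
  using assms unfolding order_merge_def order_extension_def by blast

lemma order_merge_outside:
  assumes "(x, y) \<in> order_merge P a b"
  shows "x \<in> V - {b}" "y \<in> V - {b}"
  using FieldI1[OF assms] FieldI2[OF assms] unfolding Field_eq .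

lemma order_merge_intros:
  "(x, y) \<in> P \<Longrightarrow> x \<noteq> b \<Longrightarrow> y \<noteq> b \<Longrightarrow> (x, y) \<in> order_merge P a b"
  "(b, y) \<in> P \<Longrightarrow> y \<noteq> b \<Longrightarrow> (a, y) \<in> order_merge P a b"
  "(x, b) \<in> P \<Longrightarrow> x \<noteq> b \<Longrightarrow> (x, a) \<in> order_merge P a b"
  using refl[OF ab(1)] distinct unfolding order_merge_def order_extension_def by auto

text \<open>A map with \<open>f a = f b\<close> is determined by its values off \<open>b\<close>. It
  stays strict on the quotient: a comparison through the merged point has a step to or from
  \<open>b\<close>, and that step is strict because its other end is not \<open>b\<close>.\<close>

lemma card_strict_maps_merge:
  "card {f \<in> strict_maps P n. f a = f b} = card (strict_maps (order_merge P a b) n)"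
proof (rule card_eq_of_determined_value[where V = V and t = b and h = "\<lambda>g. g a"])
  fix f assume f: "f \<in> {f \<in> strict_maps P n. f a = f b}"
  then have lt: "f x < f y" if "(x, y) \<in> P" "x \<noteq> y" for x y
    using that by (simp add: strict_iff)
  have le: "f x \<le> f y" if "(x, y) \<in> P" for x y
    using f strict_maps_mono that by blast
  have "f x < f y" if "(x, y) \<in> order_merge P a b" "x \<noteq> y" for x y
    using that(1)
  proof (cases rule: order_merge_cases)
    case 1
    then show ?thesis using lt that by blast
  next
    case 2
    \<comment> \<open>Here \<open>y \<noteq> b\<close>, so
      \<open>f x \<le> f a = f b < f y\<close>.\<close>
    then show ?thesis using le[of x a] lt[of b y] f order_merge_outside[OF that(1)] by force
  next
    case 3
    then show ?thesis using lt[of x b] le[of a y] f order_merge_outside[OF that(1)] by force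
  qed
  then have "restrict f (V - {b}) x < restrict f (V - {b}) y"
    if "(x, y) \<in> order_merge P a b" "x \<noteq> y" for x y
    using that order_merge_outside[OF that(1)] by simp
  then show "restrict f (V - {b}) \<in> strict_maps (order_merge P a b) n \<and>
      f b = restrict f (V - {b}) a"
    using f ab(1) distinct by (simp add: strict_iff)
next
  fix g assume g: "g \<in> strict_maps (order_merge P a b) n"
  then have lt: "g x < g y" if "(x, y) \<in> order_merge P a b" "x \<noteq> y" for x y
    using that by (simp add: strict_iff)
  \<comment> \<open>A pair of \<open>P\<close> containing \<open>b\<close> becomes a pair containing
    \<open>a\<close>. By incomparability its other end is not \<open>a\<close>, so strictness of
    \<open>g\<close> applies.\<close>
  have "(g(b := g a)) x < (g(b := g a)) y" if "(x, y) \<in> P" "x \<noteq> y" for x y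
    using that ab(3,4) lt[OF order_merge_intros(1)] lt[OF order_merge_intros(2)]
      lt[OF order_merge_intros(3)] by (cases "x = b"; cases "y = b") auto
  then show "g(b := g a) \<in> {f \<in> strict_maps P n. f a = f b}"
    using g ab(1,2) distinct by (auto simp: strict_iff extensional_def)
qed (use ab(2) in \<open>auto simp: strict_iff\<close>)

lemma card_weak_maps_merge:
  "card {f \<in> weak_maps P n. f a = f b} = card (weak_maps (order_merge P a b) n)"
proof (rule card_eq_of_determined_value[where V = V and t = b and h = "\<lambda>g. g a"])
  fix f assume f: "f \<in> {f \<in> weak_maps P n. f a = f b}"
  then have le: "f x \<le> f y" if "(x, y) \<in> P" for x y
    using that by (simp add: weak_iff)
  have "f x \<le> f y" if "(x, y) \<in> order_merge P a b" for x y
    using that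
  proof (cases rule: order_merge_cases)
    case 1
    then show ?thesis using le by blast
  next
    case 2
    then show ?thesis using le[of x a] le[of b y] f by simp
  next
    case 3
    then show ?thesis using le[of x b] le[of a y] f by simp
  qed
  then have "restrict f (V - {b}) x \<le> restrict f (V - {b}) y"
    if "(x, y) \<in> order_merge P a b" for x y
    using that order_merge_outside[OF that] by simp
  then show "restrict f (V - {b}) \<in> weak_maps (order_merge P a b) n \<and>
      f b = restrict f (V - {b}) a"
    using f ab(1) distinct by (simp add: weak_iff)
next
  fix g assume g: "g \<in> weak_maps (order_merge P a b) n"
  then have le: "g x \<le> g y" if "(x, y) \<in> order_merge P a b" for x y
    using that by (simp add: weak_iff)
  have "(g(b := g a)) x \<le> (g(b := g a)) y" if "(x, y) \<in> P" for x y
    using that le[OF order_merge_intros(1)] le[OF order_merge_intros(2)]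
      le[OF order_merge_intros(3)] by (cases "x = b"; cases "y = b") auto
  then show "g(b := g a) \<in> {f \<in> weak_maps P n. f a = f b}"
    using g ab(1,2) distinct by (auto simp: weak_iff extensional_def)
qed (use ab(2) in \<open>auto simp: weak_iff\<close>)

text \<open>Trichotomy of \<open>f a\<close> and \<open>f b\<close>.\<close>

lemma strict_count_split:
  "strict_count P n = strict_count (order_extension P a b) n +
     strict_count (order_extension P b a) n + strict_count (order_merge P a b) n"
proof -
  let ?S = "\<lambda>R. {f \<in> strict_maps P n. R (f a) (f b)}"
  have fin: "finite (strict_maps P n)"
    using finite by (intro finite_strict_maps) (simp add: Field_eq)
  have "card (strict_maps P n) = card ((?S (<) \<union> ?S (\<lambda>u v. v < u)) \<union> ?S (=))"
    by (rule arg_cong[where f = card]) auto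
  moreover have "card ((?S (<) \<union> ?S (\<lambda>u v. v < u)) \<union> ?S (=)) =
      card (?S (<) \<union> ?S (\<lambda>u v. v < u)) + card (?S (=))"
    using fin by (intro card_Un_disjoint) auto
  moreover have "card (?S (<) \<union> ?S (\<lambda>u v. v < u)) = card (?S (<)) + card (?S (\<lambda>u v. v < u))"
    using fin by (intro card_Un_disjoint) auto
  ultimately show ?thesis
    unfolding strict_count_eq_card strict_maps_extension
      incomparable_pair.strict_maps_extension[OF swap] card_strict_maps_merge[symmetric] by simp
qed

text \<open>Inclusion-exclusion: the cases \<open>f a \<le> f b\<close> and
  \<open>f b \<le> f a\<close> overlap in equality, which puts the quotient on the other side than
  in the strict identity.\<close>

lemma weak_count_split:
  "weak_count P n + weak_count (order_merge P a b) n =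
     weak_count (order_extension P a b) n + weak_count (order_extension P b a) n"
proof -
  let ?S = "\<lambda>R. {f \<in> weak_maps P n. R (f a) (f b)}"
  have fin: "finite (weak_maps P n)"
    using finite by (intro finite_weak_maps) (simp add: Field_eq)
  have "card (?S (\<le>)) + card (?S (\<lambda>u v. v \<le> u)) =
      card (?S (\<le>) \<union> ?S (\<lambda>u v. v \<le> u)) + card (?S (\<le>) \<inter> ?S (\<lambda>u v. v \<le> u))"
    using fin by (intro card_Un_Int) auto
  moreover have "?S (\<le>) \<union> ?S (\<lambda>u v. v \<le> u) = weak_maps P n"
    by auto
  moreover have "?S (\<le>) \<inter> ?S (\<lambda>u v. v \<le> u) = ?S (=)"
    by auto
  ultimately show ?thesis
    unfolding weak_count_eq_card weak_maps_extension
      incomparable_pair.weak_maps_extension[OF swap] card_weak_maps_merge[symmetric] by simp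
qed

text \<open>The measure for the reciprocity induction is the number of pairs outside the relation.
  Both constructions lose at least the pair \<open>(a, b)\<close> and create no new such
  pair.\<close>

lemma card_non_relation_less:
  "card (V \<times> V - order_extension P a b) < card (V \<times> V - P)"
  "card ((V - {b}) \<times> (V - {b}) - order_merge P a b) < card (V \<times> V - P)"
proof -
  show "card (V \<times> V - order_extension P a b) < card (V \<times> V - P)"
    using finite ab order_extension_base by (intro psubset_card_mono) (auto simp: order_extension_def)
  show "card ((V - {b}) \<times> (V - {b}) - order_merge P a b) < card (V \<times> V - P)"
    using finite ab by (intro psubset_card_mono) (auto simp: order_merge_def order_extension_def)
qed

end

section \<open>Reciprocity by induction, and uniqueness of the coefficients\<close>

text \<open>
  The signs are written \<open>(-1) ^ (p + i)\<close>, so that they do not involve truncated subtraction.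
\<close>

definition order_coeffs :: "'p rel \<Rightarrow> (nat \<Rightarrow> int) \<Rightarrow> bool" where
  "order_coeffs P d \<longleftrightarrow> (let p = card (Field P) in
     (\<forall>i. i \<notin> {1..p} \<longrightarrow> d i = 0) \<and>
     (\<forall>n. int (strict_count P n) = (\<Sum>i = 1..p. d i * int (n choose i))) \<and>
     (\<forall>n. int (weak_count P n) =
        (\<Sum>i = 1..p. (-1) ^ (p + i) * d i * int ((n + i - 1) choose i))))"

text \<open>The quotient has one point less, so its signs \<open>(-1) ^ (p + i)\<close> are opposite
  to those of \<open>P\<close>. This matches its negative sign in the weak identity, and one family
  of coefficients serves both counts.\<close>

lemma (in incomparable_pair) order_coeffs_add:
  assumes 1: "order_coeffs (order_extension P a b) d1"
    and 2: "order_coeffs (order_extension P b a) d2"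
    and 3: "order_coeffs (order_merge P a b) d3"
  shows "order_coeffs P (\<lambda>i. d1 i + d2 i + d3 i)"
proof -
  interpret sw: incomparable_pair V P b a by (rule swap)
  obtain q where q: "card V = Suc q" and q': "card (V - {b}) = q"
    using ab finite by (metis card_Suc_Diff1)
  have d3: "d3 i = 0" if "i \<notin> {1..q}" for i
    using 3 that by (simp add: order_coeffs_def Field_eq q')
  \<comment> \<open>Lengthens the sums of the quotient to the index range of \<open>P\<close>; the
    new term vanishes with \<open>d3 (Suc q)\<close>.\<close>
  have extend: "(\<Sum>i = 1..q. F i) = (\<Sum>i = 1..Suc q. F i)" if "d3 (Suc q) = 0 \<Longrightarrow> F (Suc q) = 0"
    for F :: "nat \<Rightarrow> int"
    using that d3[of "Suc q"] by simp
  have "int (strict_count P n) = (\<Sum>i = 1..Suc q. (d1 i + d2 i + d3 i) * int (n choose i))" for n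
  proof -
    have "int (strict_count (order_merge P a b) n) = (\<Sum>i = 1..Suc q. d3 i * int (n choose i))"
      using 3 extend[of "\<lambda>i. d3 i * int (n choose i)"] by (simp add: order_coeffs_def Field_eq q')
    then show ?thesis
      using 1 2 unfolding strict_count_split
      by (simp add: order_coeffs_def Field_eq sw.Field_eq q sum.distrib distrib_right
          del: sum.cl_ivl_Suc)
  qed
  moreover have "int (weak_count P n) =
      (\<Sum>i = 1..Suc q. (-1) ^ (Suc q + i) * (d1 i + d2 i + d3 i) * int ((n + i - 1) choose i))" for n
  proof -
    have "int (weak_count (order_merge P a b) n) =
        (\<Sum>i = 1..Suc q. (-1) ^ (q + i) * d3 i * int ((n + i - 1) choose i))"
      using 3 extend[of "\<lambda>i. (-1) ^ (q + i) * d3 i * int ((n + i - 1) choose i)"]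
      by (simp add: order_coeffs_def Field_eq q')
    moreover have "int (weak_count P n) = int (weak_count (order_extension P a b) n) +
        int (weak_count (order_extension P b a) n) - int (weak_count (order_merge P a b) n)"
      using weak_count_split[of n] by linarith
    ultimately show ?thesis
      using 1 2
      by (simp add: order_coeffs_def Field_eq sw.Field_eq q sum.distrib distrib_right
          distrib_left left_diff_distrib sum_subtractf sum_negf del: sum.cl_ivl_Suc)
  qed
  moreover have "d1 i + d2 i + d3 i = 0" if "i \<notin> {1..Suc q}" for i
    using 1 2 d3[of i] that by (auto simp: order_coeffs_def Field_eq sw.Field_eq q)
  ultimately show ?thesis
    unfolding order_coeffs_def Let_def Field_eq q by (intro conjI allI impI)
qed

text \<open>An incomparable pair reduces \<open>P\<close> to three posets of smaller measure;
  without such a pair \<open>P\<close> is a chain.\<close>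

lemma order_reciprocity:
  assumes "finite V" "V \<noteq> {}" "partial_order_on V P"
  shows "\<exists>d. order_coeffs P d"
  using assms
proof (induction "card (V \<times> V - P)" arbitrary: V P rule: less_induct)
  case less
  show ?case
  proof (cases "\<exists>a\<in>V. \<exists>b\<in>V. (a, b) \<notin> P \<and> (b, a) \<notin> P")
    case True
    then obtain a b where "a \<in> V" "b \<in> V" "(a, b) \<notin> P" "(b, a) \<notin> P" by blast
    then interpret incomparable_pair V P a b
      by unfold_locales (use less.prems in auto)
    interpret sw: incomparable_pair V P b a by (rule swap)
    \<comment> \<open>The point \<open>a\<close> survives, so the induction hypothesis applies to
      the quotient.\<close>
    have "V - {b} \<noteq> {}"
      using ab distinct by blast
    then show ?thesis
      using order_coeffs_add less.hyps[OF card_non_relation_less(1) finite less.prems(2) poset_extension]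
        less.hyps[OF sw.card_non_relation_less(1) finite less.prems(2) sw.poset_extension]
        less.hyps[OF card_non_relation_less(2) _ _ poset_merge] finite by blast
  next
    case False
    then have lin: "linear_order_on V P"
      using less.prems(3) by (auto simp: linear_order_on_def total_on_def)
    have F: "Field P = V"
      using less.prems(3) by (rule Field_eq_of_partial_order_on)
    have p: "card V \<in> {1..card V}"
      using less.prems by (simp add: Suc_le_eq card_gt_0_iff)
    \<comment> \<open>For a chain both counts are single binomial coefficients, so only the top
      coefficient is nonzero; its sign \<open>(-1) ^ (p + p)\<close> is positive.\<close>
    have "order_coeffs P (\<lambda>i. if i = card V then 1 else 0)"
      using p counts_linear_order[OF less.prems(1) lin]
      by (auto simp: order_coeffs_def F Let_def if_distrib[of "\<lambda>c. _ * c"]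
          if_distrib[of "\<lambda>c. c * _"] cong: if_cong simp flip: mult_2)
    then show ?thesis
      by blast
  qed
qed

text \<open>Evaluation at \<open>n\<close> kills the terms with \<open>i > n\<close>, so the linear
  system is triangular with ones on the diagonal.\<close>

lemma binomial_expansion_unique:
  fixes d e :: "nat \<Rightarrow> int"
  assumes "\<And>i. i \<notin> {1..p} \<Longrightarrow> d i = 0" "\<And>i. i \<notin> {1..p} \<Longrightarrow> e i = 0"
    and eq: "\<And>n. (\<Sum>i = 1..p. d i * int (n choose i)) = (\<Sum>i = 1..p. e i * int (n choose i))"
  shows "d = e"
proof
  fix n
  show "d n = e n"
  proof (induction n rule: less_induct)
    case (less n)
    show ?case
    proof (cases "n \<in> {1..p}")
      case True
      have "(\<Sum>i\<in>{1..p} - {n}. d i * int (n choose i)) = (\<Sum>i\<in>{1..p} - {n}. e i * int (n choose i))"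
        using less by (intro sum.cong refl) (metis DiffD2 binomial_eq_0_iff insert_iff linorder_neqE_nat mult_zero_right of_nat_0)
      then show ?thesis
        using eq[of n] True by (simp add: sum.remove)
    qed (use assms in auto)
  qed
qed

text \<open>\<open>d_coeff\<close> is described by the strict count alone. By uniqueness it is the
  family found by reciprocity, so the weak expansion holds for it as well.\<close>

lemma order_coeffs_d_coeff:
  assumes "finite V" "V \<noteq> {}" "partial_order_on V P"
  shows "order_coeffs P (d_coeff P)"
proof -
  obtain d where d: "order_coeffs P d"
    using order_reciprocity[OF assms] ..
  have "d_coeff P = d"
    unfolding d_coeff_def
    by (rule the_equality, use d in \<open>simp add: order_coeffs_def Let_def\<close>)
      (rule binomial_expansion_unique[of "card (Field P)"],
       use d in \<open>auto simp: order_coeffs_def Let_def\<close>)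
  then show ?thesis
    using d by simp
qed

section \<open>The change of basis\<close>

interpretation fps_scale: vector_space "fps_scale :: 'a::field_char_0 \<Rightarrow> 'a fps \<Rightarrow> 'a fps"
  by unfold_locales
    (simp_all add: fps_scale_def algebra_simps flip: fps_const_add fps_const_mult)

text \<open>The negative binomial series, shifted by the factor \<open>fps_X\<close>. The value at 0
  is set apart because for \<open>n = i = 0\<close> truncated subtraction would make the binomial
  1.\<close>

lemma fps_X_over_one_minus_X_power_nth:
  fixes i n :: nat
  shows "fps_nth (fps_X / (1 - fps_X) ^ (i + 1) :: 'a::field_char_0 fps) n =
    (if n = 0 then 0 else of_nat ((n + i - 1) choose i))"
proof -
  have "(fps_X / (1 - fps_X) ^ (i + 1) :: 'a fps) = fps_X * inverse ((1 - fps_X) ^ (i + 1))"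
    by (rule fps_divide_unit) (simp add: fps_power_zeroth)
  also have "inverse ((1 - fps_X) ^ (i + 1)) = Abs_fps (\<lambda>n. of_nat ((n + i) choose i) :: 'a)"
    using one_minus_const_fps_X_neg_power'[of "i + 1" "1 :: 'a"]
    by (simp add: binomial_symmetric[of i] add.commute del: power_Suc)
  finally show ?thesis
    by (simp add: fps_X_mult_nth)
qed

text \<open>
  The substitution \<open>X \<mapsto> - X / (1 - X)\<close> exchanges \<open>1 - X\<close> and its inverse.
\<close>

lemma ex_change_of_basis: "\<exists>\<phi> :: 'a::field_char_0 fps \<Rightarrow> 'a fps. is_change_of_basis \<phi>"
proof -
  define v :: "'a fps" where "v = inverse (1 - fps_X)"
  define g where "g = - fps_X * v"
  \<comment> \<open>The substitution sends \<open>X / (1 - X) ^ (k + 1)\<close> to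
    \<open>- X * (1 - X) ^ k\<close>; the factor \<open>- v\<close> corrects the sign and removes
    one power of \<open>1 - X\<close>.\<close>
  define \<phi> where "\<phi> f = - (f oo g) * v" for f
  have v: "(1 - fps_X) * v = 1"
    unfolding v_def by (rule inverse_mult_eq_1') simp
  have g0: "fps_nth g 0 = 0"
    by (simp add: g_def)
  have X: "fps_X oo g = g"
    by (rule fps_X_fps_compose_startby0) (rule g0)
  have one_minus: "(1 - fps_X) oo g = v"
    using v by (simp add: fps_compose_sub_distrib X g_def algebra_simps)
  have "\<phi> (fps_X / (1 - fps_X) ^ (k + 1)) = fps_X * (1 - fps_X) ^ (k - 1)" if "k \<ge> 1" for k
  proof -
    define F where "F = (fps_X / (1 - fps_X) ^ (k + 1) :: 'a fps)"
    have "F * (1 - fps_X) ^ (k + 1) = fps_X"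
      unfolding F_def by (simp add: fps_divide_unit fps_power_zeroth mult.assoc inverse_mult_eq_1)
    then have "(F oo g) * v ^ (k + 1) = g"
      using X one_minus by (metis fps_compose_mult_distrib fps_compose_power g0)
    then have "(F oo g) * (v * (1 - fps_X)) ^ (k + 1) = g * (1 - fps_X) ^ (k + 1)"
      unfolding power_mult_distrib by (metis mult.assoc)
    then have "F oo g = g * (1 - fps_X) ^ (k + 1)"
      using v by (simp add: mult.commute[of v] del: power_Suc)
    then have "\<phi> F = fps_X * (v * (v * (1 - fps_X) ^ (k + 1)))"
      by (simp add: \<phi>_def g_def mult_ac)
    \<comment> \<open>Two factors are split off, possible as \<open>k \<ge> 1\<close>, to cancel
      both copies of \<open>v\<close>.\<close>
    also have "(1 - fps_X :: 'a fps) ^ (k + 1) = (1 - fps_X) * ((1 - fps_X) * (1 - fps_X) ^ (k - 1))"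
      using that by (cases k) simp_all
    also have "v * (v * \<dots>) = ((1 - fps_X) * v) * (((1 - fps_X) * v) * (1 - fps_X) ^ (k - 1))"
      by (simp only: mult_ac)
    finally show ?thesis
      by (simp add: v F_def)
  qed
  moreover have "\<phi> (a + b) = \<phi> a + \<phi> b" for a b
    by (simp add: \<phi>_def fps_compose_add_distrib algebra_simps)
  moreover have "\<phi> (fps_scale c f) = fps_scale c (\<phi> f)" for c f
    by (simp add: \<phi>_def fps_scale_def fps_compose_mult_distrib[OF g0] mult_ac)
  ultimately have "is_change_of_basis \<phi>"
    unfolding is_change_of_basis_def by blast
  then show ?thesis
    by blast
qed

text \<open>Linearity of \<open>\<phi>\<close> is given only on the span, so the induction also
  checks that each term and each partial sum lies there.\<close>

lemma change_of_basis_sum: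
  fixes c :: "nat \<Rightarrow> 'a::field_char_0"
  assumes \<phi>: "is_change_of_basis \<phi>" and "finite I" "\<And>i. i \<in> I \<Longrightarrow> i \<ge> 1"
  shows "\<phi> (\<Sum>i\<in>I. fps_scale (c i) (fps_X / (1 - fps_X) ^ (i + 1))) =
    (\<Sum>i\<in>I. fps_scale (c i) (fps_X * (1 - fps_X) ^ (i - 1)))"
proof -
  let ?S = "module.span fps_scale weak_basis :: 'a fps set"
  let ?b = "\<lambda>i. fps_X / (1 - fps_X) ^ (i + 1) :: 'a fps"
  have b: "?b i \<in> ?S" if "i \<ge> 1" for i
    using that by (intro fps_scale.span_base) (auto simp: weak_basis_def)
  have add: "\<phi> (f + g) = \<phi> f + \<phi> g" if "f \<in> ?S" "g \<in> ?S" for f g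
    using \<phi> that unfolding is_change_of_basis_def by blast
  have scale: "\<phi> (fps_scale d f) = fps_scale d (\<phi> f)" if "f \<in> ?S" for d f
    using \<phi> that unfolding is_change_of_basis_def by blast
  have basis: "\<phi> (?b i) = fps_X * (1 - fps_X) ^ (i - 1)" if "i \<ge> 1" for i
    using \<phi> that unfolding is_change_of_basis_def by blast
  show ?thesis
    using assms(2,3)
  proof (induction I rule: finite_induct)
    case empty
    then show ?case
      \<comment> \<open>Homogeneity with scalar 0 yields \<open>\<phi> 0 = 0\<close>.\<close>
      using scale[OF fps_scale.span_zero, of 0] by simp
  next
    case (insert i I)
    have "(\<Sum>i\<in>I. fps_scale (c i) (?b i)) \<in> ?S"
      using insert.prems by (intro fps_scale.span_sum fps_scale.span_scale b) auto
    moreover have "fps_scale (c i) (?b i) \<in> ?S"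
      using insert.prems by (intro fps_scale.span_scale b) auto
    ultimately show ?case
      using insert b[of i] basis[of i] by (simp add: add scale del: power_Suc)
  qed
qed

section \<open>The two series of a poset\<close>

lemma FP_order_coeffs:
  assumes "P \<in> FP k"
  shows "order_coeffs P (d_coeff P)"
  using order_coeffs_d_coeff[OF _ _ FP_D(2)[OF assms]] FP_D(1)[OF assms]
  by (auto simp: lessThan_empty_iff)

text \<open>Reciprocity read coefficientwise: the binomials in the weak expansion are the
  coefficients of the basis series.\<close>

lemma weak_order_series_expansion:
  assumes "P \<in> FP k"
  defines "p \<equiv> card (Field P)"
  shows "(weak_order_series P :: 'a::field_char_0 fps) =
    (\<Sum>i = 1..p. fps_scale ((-1) ^ (p - i) * of_int (d_coeff P i)) (fps_X / (1 - fps_X) ^ (i + 1)))"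
proof (rule fps_ext)
  fix n
  \<comment> \<open>The exponents differ by the even number \<open>2 * i\<close>; the subtraction is
    exact because \<open>i \<le> p\<close>.\<close>
  have sign: "(-1 :: int) ^ (p + i) = (-1) ^ (p - i)" if "i \<in> {1..p}" for i
  proof -
    have "p + i = (p - i) + 2 * i" using that by simp
    then show ?thesis by (simp only: power_add) simp
  qed
  have "int (weak_count P n) =
      (\<Sum>i = 1..p. (-1) ^ (p + i) * d_coeff P i * int ((n + i - 1) choose i))"
    using FP_order_coeffs[OF assms(1)] by (simp add: order_coeffs_def p_def Let_def)
  also have "\<dots> = (\<Sum>i = 1..p. (-1) ^ (p - i) * d_coeff P i * int ((n + i - 1) choose i))"
    using sign by (intro sum.cong) auto
  finally have "(of_int (int (weak_count P n)) :: 'a) =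
      of_int (\<Sum>i = 1..p. (-1) ^ (p - i) * d_coeff P i * int ((n + i - 1) choose i))"
    by (rule arg_cong)
  then show "fps_nth (weak_order_series P :: 'a fps) n = fps_nth (\<Sum>i = 1..p.
      fps_scale ((-1) ^ (p - i) * of_int (d_coeff P i)) (fps_X / (1 - fps_X) ^ (i + 1))) n"
    unfolding fps_sum_nth fps_scale_def fps_mult_left_const_nth fps_X_over_one_minus_X_power_nth
    by (simp add: weak_order_series_def)
qed

lemma weak_surj_series_expansion:
  "(weak_surj_series P :: 'a::field_char_0 fps) =
    (\<Sum>i = 1..card (Field P). fps_scale ((-1) ^ (card (Field P) - i) * of_int (d_coeff P i))
      (fps_X * (1 - fps_X) ^ (i - 1)))"
  unfolding weak_surj_series_def fps_scale_def
  by (simp add: fps_of_int flip: fps_const_mult fps_const_power fps_const_neg)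

lemma change_of_basis_weak_order_series:
  fixes \<phi> :: "'a::field_char_0 fps \<Rightarrow> 'a fps"
  assumes "is_change_of_basis \<phi>" "P \<in> FP k"
  shows "\<phi> (weak_order_series P) = weak_surj_series P"
  unfolding weak_order_series_expansion[OF assms(2)] weak_surj_series_expansion
  by (rule change_of_basis_sum[OF assms(1)]) auto

section \<open>The algebras of series\<close>

lemma lex_comp_closed:
  assumes "P \<in> FP (length Qs)" "set Qs \<subseteq> finite_posets"
  shows "lex_comp P Qs \<in> finite_posets"
proof -
  interpret lex_composition P Qs "\<lambda>i. card (Field (Qs ! i))"
    using assms(1) finite_posets_FP[OF subsetD[OF assms(2) nth_mem]] by unfold_locales
  show ?thesis
    using lex_comp_FP by (auto simp: finite_posets_def)
qed

text \<open>Elements carry their posets and the action reads only these, so for any \<open>Z\<close>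
  the algebra laws reduce to closure, unit and associativity of \<open>lex_comp\<close>.\<close>

lemma FP_algebra_series:
  fixes Z :: "nat rel \<Rightarrow> 's"
  shows "FP_algebra (series_algebra Z) (series_action Z)"
  unfolding FP_algebra_def
proof (intro conjI allI ballI impI)
  fix k P and xs :: "(nat rel \<times> 's) list"
  assume "P \<in> FP k" "length xs = k \<and> set xs \<subseteq> series_algebra Z"
  then have "lex_comp P (map fst xs) \<in> finite_posets"
    by (intro lex_comp_closed) (auto simp: series_algebra_def)
  then show "series_action Z P xs \<in> series_algebra Z"
    by (simp add: series_action_def series_algebra_def Let_def)
next
  fix a assume "a \<in> series_algebra Z"
  then obtain Q k where "a = (Q, Z Q)" "Q \<in> FP k"
    by (auto simp: series_algebra_def finite_posets_def)
  then show "series_action Z {(0, 0)} [a] = a"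
    by (simp add: series_action_def lex_comp_unit)
next
  fix k P Qs and xss :: "(nat rel \<times> 's) list list"
  assume P: "P \<in> FP k" and *: "length Qs = k \<and> length xss = k \<and>
    (\<forall>i<k. Qs ! i \<in> FP (length (xss ! i)) \<and> set (xss ! i) \<subseteq> series_algebra Z)"
  have posets: "map (map fst) xss ! i ! a \<in> finite_posets"
    if "i < length Qs" "a < length (map (map fst) xss ! i)" for i a
  proof -
    have "xss ! i ! a \<in> series_algebra Z"
      using * that by (auto dest: nth_mem)
    then show ?thesis
      using * that by (auto simp: series_algebra_def)
  qed
  have "map fst (map2 (series_action Z) Qs xss) = map2 lex_comp Qs (map (map fst) xss)"
    by (rule nth_equalityI) (simp_all add: series_action_def Let_def)
  moreover have "lex_comp (lex_comp P Qs) (concat (map (map fst) xss)) =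
      lex_comp P (map2 lex_comp Qs (map (map fst) xss))"
    using P * posets by (intro lex_comp_assoc) auto
  ultimately show "series_action Z (lex_comp P Qs) (concat xss) =
      series_action Z P (map2 (series_action Z) Qs xss)"
    by (simp add: series_action_def map_concat)
qed

text \<open>The map keeps the posets, hence commutes with the actions once \<open>\<phi>\<close>
  carries \<open>Z\<close> to \<open>Z'\<close>. It is bijective because an inverse can rebuild
  \<open>Z P\<close> from the retained \<open>P\<close>.\<close>

lemma operadic_isomorphism_series:
  assumes \<phi>: "\<And>P. P \<in> finite_posets \<Longrightarrow> \<phi> (Z P) = Z' P"
  shows "operadic_isomorphism (series_algebra Z) (series_action Z)
    (series_algebra Z') (series_action Z') (\<lambda>(P, f). (P, \<phi> f))"
  unfolding operadic_isomorphism_def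
proof (intro conjI allI ballI impI)
  show "bij_betw (\<lambda>(P, f). (P, \<phi> f)) (series_algebra Z) (series_algebra Z')"
    by (rule bij_betw_byWitness[where f' = "\<lambda>(P, _). (P, Z P)"])
      (auto simp: series_algebra_def \<phi>)
next
  fix k P xs assume "P \<in> FP k" and xs: "length xs = k \<and> set xs \<subseteq> series_algebra Z"
  then have "lex_comp P (map fst xs) \<in> finite_posets"
    by (intro lex_comp_closed) (auto simp: series_algebra_def)
  moreover have "map fst (map (\<lambda>(P, f). (P, \<phi> f)) xs) = map fst xs"
    by auto
  ultimately show "(\<lambda>(P, f). (P, \<phi> f)) (series_action Z P xs) =
      series_action Z' P (map (\<lambda>(P, f). (P, \<phi> f)) xs)"
    by (simp only: series_action_def Let_def split_conv \<phi>)
qed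

theorem corollary3p6:
  shows "FP_algebra (series_algebra (weak_order_series :: nat rel \<Rightarrow> 'a::field_char_0 fps))
           (series_action weak_order_series) \<and>
         FP_algebra (series_algebra (weak_surj_series :: nat rel \<Rightarrow> 'a fps))
           (series_action weak_surj_series) \<and>
         (\<exists>\<phi> :: 'a fps \<Rightarrow> 'a fps. is_change_of_basis \<phi>) \<and>
         (\<forall>\<phi> :: 'a fps \<Rightarrow> 'a fps. is_change_of_basis \<phi> \<longrightarrow>
            operadic_isomorphism
              (series_algebra weak_order_series) (series_action weak_order_series)
              (series_algebra weak_surj_series) (series_action weak_surj_series)
              (\<lambda>(P, f). (P, \<phi> f)))"
proof (intro conjI allI impI)
  fix \<phi> :: "'a fps \<Rightarrow> 'a fps"
  assume "is_change_of_basis \<phi>"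
  then show "operadic_isomorphism
      (series_algebra weak_order_series) (series_action weak_order_series)
      (series_algebra weak_surj_series) (series_action weak_surj_series)
      (\<lambda>(P, f). (P, \<phi> f))"
    using change_of_basis_weak_order_series
    by (intro operadic_isomorphism_series) (auto simp: finite_posets_def)
qed (rule FP_algebra_series ex_change_of_basis)+

end
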